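(* Let $m,n\ge 1$ be integers, let $K\subset\mathbb{R}^n$ be a bounded set, let $\varepsilon\ge 0$, and let $A$ be an $m\times n$ random matrix with i.i.d. $N(0,1)$ entries. For each $x\in K$ let $$y=Ax+\nu,\qquad \frac1m\|\nu\|_1=\frac1m\sum_{i=1}^m|\nu_i|\le\varepsilon,$$ where the noise vector $\nu\in\mathbb{R}^m$ is otherwise arbitrary (in particular it may depend on $A$). Choose $\widehat{x}$ to be any vector satisfying $$\widehat{x}\in K\quad\text{and}\quad \frac1m\|A\widehat{x}-y\|_1\le\varepsilon .$$ Then $$\mathbb{E}\,\sup_{x\in K}\|\widehat{x}-x\|_2\le\sqrt{8\pi}\,\left(\frac{w(K)}{\sqrt m}+\varepsilon\right).$$
   Context: The Gaussian mean width of a bounded set $K\subset\mathbb{R}^n$ is $w(K)=\mathbb{E}\sup_{u\in K-K}\langle g,u\rangle$, where $g\sim N(0,I_n)$ and $K-K=\{u-v:u,v\in K\}$. The vector $\widehat{x}$ depends on $A$ and $y$. *)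

theory Defs
  imports "HOL-Probability.Probability"
begin

definition l1_norm :: "real ^ 'k \<Rightarrow> real" where
  "l1_norm v = (\<Sum>i\<in>UNIV. \<bar>v $ i\<bar>)"

(* The law N(0, I_n) on R^n: independent standard normal coordinates. *)
definition std_gaussian :: "(real ^ 'n) measure" where
  "std_gaussian =
     distr (\<Pi>\<^sub>M i\<in>(UNIV :: 'n set). density lborel std_normal_density) borel
       (\<lambda>f. \<chi> i. f i)"

(* For bounded nonempty K the supremum is a finite real number, since K - K is bounded
   and contains 0. *)
definition gaussian_mean_width :: "(real ^ 'n) set \<Rightarrow> real" where
  "gaussian_mean_width K =
     (\<integral>g. (SUP u\<in>{u - v | u v. u \<in> K \<and> v \<in> K}. g \<bullet> u) \<partial>std_gaussian)"

definition iid_std_normal_matrix :: "'w measure \<Rightarrow> ('w \<Rightarrow> real ^ 'n ^ 'm) \<Rightarrow> bool" where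
  "iid_std_normal_matrix M A \<longleftrightarrow>
     prob_space.indep_vars M (\<lambda>_. borel) (\<lambda>(i, j) \<omega>. A \<omega> $ i $ j) (UNIV :: ('m \<times> 'n) set) \<and>
     (\<forall>i j. distributed M lborel (\<lambda>\<omega>. A \<omega> $ i $ j) std_normal_density)"

(* Outer expectation: the least expectation of a measurable majorant. It is used because a
   supremum over an uncountable set of errors of an arbitrary estimator need not be
   measurable; the library's nn_integral would be the smaller, inner, integral there. The
   two lemmas below show that it is the usual expectation whenever that makes sense. *)
definition outer_expectation :: "'w measure \<Rightarrow> ('w \<Rightarrow> ennreal) \<Rightarrow> ennreal" where
  "outer_expectation M f =
     (INF h\<in>{h \<in> borel_measurable M. \<forall>\<omega>\<in>space M. f \<omega> \<le> h \<omega>}. \<integral>\<^sup>+\<omega>. h \<omega> \<partial>M)"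

lemma outer_expectation_eq_nn_integral:
  assumes "f \<in> borel_measurable M"
  shows "outer_expectation M f = (\<integral>\<^sup>+\<omega>. f \<omega> \<partial>M)"
  unfolding outer_expectation_def
proof (rule antisym)
  show "(INF h\<in>{h \<in> borel_measurable M. \<forall>\<omega>\<in>space M. f \<omega> \<le> h \<omega>}. \<integral>\<^sup>+\<omega>. h \<omega> \<partial>M)
      \<le> (\<integral>\<^sup>+\<omega>. f \<omega> \<partial>M)"
    by (rule INF_lower) (use assms in auto)
  show "(\<integral>\<^sup>+\<omega>. f \<omega> \<partial>M)
      \<le> (INF h\<in>{h \<in> borel_measurable M. \<forall>\<omega>\<in>space M. f \<omega> \<le> h \<omega>}. \<integral>\<^sup>+\<omega>. h \<omega> \<partial>M)"
    by (rule INF_greatest) (auto intro: nn_integral_mono)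
qed

lemma outer_expectation_eq_integral:
  assumes "integrable M f" and "\<And>\<omega>. 0 \<le> f \<omega>"
  shows "outer_expectation M (\<lambda>\<omega>. ennreal (f \<omega>)) = ennreal (\<integral>\<omega>. f \<omega> \<partial>M)"
  using assms by (simp add: outer_expectation_eq_nn_integral nn_integral_eq_integral)

end

theory Submission
  imports Defs
begin

text \<open>
  Both \<open>xhat\<close> and \<open>x\<close> are nearly consistent with the data, so \<open>u = xhat - x\<close> lies in \<open>T = K - K\<close> and
  satisfies \<open>\<Sum>i. \<bar>a\<^sub>i \<bullet> u\<bar> \<le> 2 m \<epsilon>\<close>, where the \<open>a\<^sub>i\<close> are the rows of \<open>A\<close>. As
  \<open>E \<bar>a \<bullet> u\<bar> = c * norm u\<close> with \<open>c = sqrt (2 / pi)\<close>, it suffices to bound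
  \<open>E sup (\<Sum>i. c * norm u - \<bar>a\<^sub>i \<bullet> u\<bar>)\<close> over \<open>T\<close> by
  \<open>E sup (2 * (\<Sum>i. a\<^sub>i) \<bullet> u) = 2 * sqrt m * w(K)\<close>. The rows are replaced one at a time by symmetrization
  and contraction, which for a single Gaussian row is elementary: an independent copy \<open>a'\<close> splits
  the supremum into one over \<open>h u / 2 + \<bar>a' \<bullet> u\<bar>\<close> and one over \<open>h v / 2 - \<bar>a \<bullet> v\<bar>\<close>; after renaming
  \<open>a'\<close> to \<open>a\<close>, the inequality \<open>\<bar>a \<bullet> u\<bar> - \<bar>a \<bullet> v\<bar> \<le> \<bar>a \<bullet> (u - v)\<bar>\<close> and the symmetry in \<open>u\<close>, \<open>v\<close> remove
  the absolute values. All suprema are taken in \<open>ennreal\<close> over a countable dense subset of \<open>T\<close>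
  containing 0, which settles measurability and integrability; negative values are truncated
  to 0, harmlessly since 0 contributes the value 0.
\<close>

section \<open>Standard Gaussian vectors: coordinates, symmetry and linear functionals\<close>

lemma borel_measurable_vec_lambda [measurable (raw)]:
  fixes f :: "'k::finite \<Rightarrow> 'w \<Rightarrow> real"
  assumes [measurable]: "\<And>i. f i \<in> borel_measurable M"
  shows "(\<lambda>x. \<chi> i. f i x) \<in> borel_measurable M"
proof (rule borel_measurable_euclidean_space[THEN iffD2], rule ballI)
  fix b :: "real ^ 'k" assume "b \<in> Basis"
  then obtain i where "b = axis i 1"
    by (auto simp: Basis_vec_def)
  then show "(\<lambda>x. (\<chi> i. f i x) \<bullet> b) \<in> borel_measurable M"
    by (simp add: inner_axis)
qed

lemma borel_measurable_vec_nth [measurable]: "(\<lambda>x :: real ^ 'k. x $ i) \<in> borel_measurable borel"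
  by (intro borel_measurable_continuous_onI continuous_intros)

lemma prob_space_std_normal: "prob_space (density lborel std_normal_density)"
  by (rule prob_space_normal_density) simp

text \<open>Independence makes the joint law the product of the marginals, and
  \<open>std_gaussian\<close> is the image of exactly that product. Negated vectors, rows and
  normalized row sums are all recognized as Gaussian by this criterion.\<close>

lemma (in prob_space) distr_indep_std_normal:
  assumes "indep_vars (\<lambda>_. borel) X (UNIV :: 'k::finite set)"
    and D: "\<And>i. distributed M lborel (X i) std_normal_density"
  shows "distr M borel (\<lambda>\<omega>. \<chi> i. X i \<omega>) = std_gaussian"
proof -
  have [measurable]: "\<And>i. X i \<in> borel_measurable M"
    using distributed_measurable[OF D] by simp
  have "distr M (\<Pi>\<^sub>M i\<in>UNIV. borel) (\<lambda>\<omega>. \<lambda>i\<in>UNIV. X i \<omega>) = (\<Pi>\<^sub>M i\<in>UNIV. distr M borel (X i))"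
    using assms(1) by (subst (asm) indep_vars_iff_distr_eq_PiM) auto
  also have "\<dots> = (\<Pi>\<^sub>M i\<in>UNIV. density lborel std_normal_density)"
  proof (rule PiM_cong[OF refl])
    fix i
    have "distr M borel (X i) = distr M lborel (X i)" by (rule distr_cong) auto
    then show "distr M borel (X i) = density lborel std_normal_density"
      using distributed_distr_eq_density[OF D] by simp
  qed
  finally have *: "distr M (\<Pi>\<^sub>M i\<in>UNIV. borel) (\<lambda>\<omega>. \<lambda>i\<in>UNIV. X i \<omega>) = (\<Pi>\<^sub>M i\<in>UNIV. density lborel std_normal_density)" .
  show ?thesis
    unfolding std_gaussian_def *[symmetric]
    by (subst distr_distr) (auto simp: vec_eq_iff intro!: distr_cong)
qed

lemma sets_std_gaussian [simp, measurable_cong]: "sets std_gaussian = sets borel"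
  by (simp add: std_gaussian_def)

lemma space_std_gaussian [simp]: "space std_gaussian = UNIV"
  by (simp add: std_gaussian_def)

lemma prob_space_std_gaussian: "prob_space (std_gaussian :: (real ^ 'k) measure)"
  unfolding std_gaussian_def
proof (rule prob_space.prob_space_distr)
  show "prob_space (\<Pi>\<^sub>M i\<in>(UNIV::'k set). density lborel std_normal_density)"
    by (intro prob_space_PiM prob_space_std_normal)
qed measurable

text \<open>The converse of the criterion above; it makes results on sums and affine images of
  independent normal variables applicable to \<open>std_gaussian\<close>.\<close>

lemma std_gaussian_coordinates:
  shows "prob_space.indep_vars std_gaussian (\<lambda>_. borel) (\<lambda>(i::'k::finite) x. x $ i) UNIV"
    and "\<And>i :: 'k. distributed std_gaussian lborel (\<lambda>x. x $ i) std_normal_density"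
proof -
  let ?N = "density lborel std_normal_density"
  let ?P = "\<Pi>\<^sub>M i\<in>(UNIV::'k set). ?N"
  have N: "distr std_gaussian borel (\<lambda>x :: real ^ 'k. x $ i) = ?N" for i
  proof -
    have "distr std_gaussian borel (\<lambda>x. x $ i) = distr ?P borel (\<lambda>f. f i)"
      unfolding std_gaussian_def by (subst distr_distr) (auto simp: comp_def)
    also have "\<dots> = distr ?P ?N (\<lambda>f. f i)" by (rule distr_cong) auto
    also have "\<dots> = ?N" by (rule distr_PiM_component) (auto intro: prob_space_std_normal)
    finally show ?thesis .
  qed
  show "distributed std_gaussian lborel (\<lambda>x. x $ i) std_normal_density" for i :: 'k
    unfolding distributed_def N[of i, symmetric] by (auto intro: distr_cong)
  interpret prob_space "std_gaussian :: (real ^ 'k) measure" by (rule prob_space_std_gaussian)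
  have "distr std_gaussian (\<Pi>\<^sub>M i\<in>UNIV. borel) (\<lambda>x :: real ^ 'k. \<lambda>i\<in>UNIV. x $ i)
      = distr ?P (\<Pi>\<^sub>M i\<in>UNIV. borel) (\<lambda>f. \<lambda>i\<in>UNIV. f i)"
    unfolding std_gaussian_def by (subst distr_distr) (auto simp: fun_eq_iff intro!: distr_cong)
  also have "\<dots> = ?P"
    by (auto simp: restrict_UNIV intro!: distr_id2 sets_PiM_cong)
  also have "\<dots> = (\<Pi>\<^sub>M i\<in>UNIV. distr std_gaussian borel (\<lambda>x. x $ i))"
    by (simp add: N)
  finally show "indep_vars (\<lambda>_. borel) (\<lambda>(i::'k) x. x $ i) UNIV"
    by (subst indep_vars_iff_distr_eq_PiM) auto
qed

lemma std_gaussian_symmetric: "distr std_gaussian borel uminus = (std_gaussian :: (real ^ 'k) measure)"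
proof -
  interpret prob_space "std_gaussian :: (real ^ 'k) measure" by (rule prob_space_std_gaussian)
  have "distr std_gaussian borel (\<lambda>x :: real ^ 'k. \<chi> i. - x $ i) = std_gaussian"
  proof (rule distr_indep_std_normal)
    show "indep_vars (\<lambda>_. borel) (\<lambda>(i::'k) x. - x $ i) UNIV"
      using indep_vars_compose2[OF std_gaussian_coordinates(1), of "\<lambda>_. uminus" "\<lambda>_. borel"] by simp
    show "distributed std_gaussian lborel (\<lambda>x. - x $ i) std_normal_density" for i :: 'k
      using normal_density_affine[OF std_gaussian_coordinates(2), of "-1" 0 i] by simp
  qed
  then show ?thesis by (simp add: vec_eq_iff[symmetric] vec_lambda_unique uminus_vec_def[abs_def])
qed

lemma distributed_std_gaussian_inner:
  fixes u :: "real ^ 'k"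
  assumes "u \<noteq> 0"
  shows "distributed std_gaussian lborel (\<lambda>x. x \<bullet> u) (normal_density 0 (norm u))"
proof -
  interpret prob_space "std_gaussian :: (real ^ 'k) measure" by (rule prob_space_std_gaussian)
  \<comment> \<open>Zero coordinates are dropped because each summand needs a positive standard
    deviation \<open>\<bar>u $ i\<bar>\<close>.\<close>
  let ?I = "{i. u $ i \<noteq> 0}"
  have "distributed std_gaussian lborel (\<lambda>x. \<Sum>i\<in>?I. u $ i * x $ i)
      (normal_density (\<Sum>i\<in>?I. 0) (sqrt (\<Sum>i\<in>?I. \<bar>u $ i\<bar>\<^sup>2)))"
  proof (rule sum_indep_normal)
    show "?I \<noteq> {}" using assms by (auto simp: vec_eq_iff)
    show "indep_vars (\<lambda>_. borel) (\<lambda>i x. u $ i * x $ i) ?I"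
      using indep_vars_compose2[OF std_gaussian_coordinates(1), of "\<lambda>i t. u $ i * t" "\<lambda>_. borel"]
      by (auto intro: indep_vars_subset)
    fix i assume "i \<in> ?I"
    then show "0 < \<bar>u $ i\<bar>" "distributed std_gaussian lborel (\<lambda>x. u $ i * x $ i) (normal_density 0 \<bar>u $ i\<bar>)"
      using normal_density_affine[OF std_gaussian_coordinates(2), of "u $ i" 0 i] by auto
  qed auto
  moreover have "(\<Sum>i\<in>?I. u $ i * x $ i) = x \<bullet> u" for x
    unfolding inner_vec_def by (rule sum.mono_neutral_cong_left) auto
  moreover have "sqrt (\<Sum>i\<in>?I. \<bar>u $ i\<bar>\<^sup>2) = norm u"
    unfolding norm_vec_def L2_set_def by (intro arg_cong[where f=sqrt] sum.mono_neutral_cong_left) auto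
  ultimately show ?thesis by simp
qed

text \<open>Source of the constant: the first absolute moment of a centered normal variable with
  standard deviation \<open>norm u\<close>, that is, the odd moment \<open>2 * k + 1\<close> at
  \<open>k = 0\<close>. The degenerate case \<open>u = 0\<close> has no density and is
  separate.\<close>

lemma has_bochner_integral_std_gaussian_abs_inner:
  fixes u :: "real ^ 'k"
  shows "has_bochner_integral std_gaussian (\<lambda>x. \<bar>x \<bullet> u\<bar>) (sqrt (2 / pi) * norm u)"
proof (cases "u = 0")
  case False
  note D = distributed_std_gaussian_inner[OF False]
  have "has_bochner_integral lborel (\<lambda>t. normal_density 0 (norm u) t * \<bar>t\<bar>) (sqrt (2 / pi) * norm u)"
    using normal_moment_abs_odd[of "norm u" 0 0] False by (simp add: mult.commute)
  then show ?thesis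
    using distributed_integrable[OF D, of abs] distributed_integral[OF D, of abs]
    by (simp add: has_bochner_integral_iff)
qed (simp add: has_bochner_integral_zero)

section \<open>Symmetrization and contraction, one Gaussian row at a time\<close>

lemma ennreal_add_le: "ennreal (p + q) \<le> ennreal p + ennreal q"
  by (simp add: ennreal_plus_if ennreal_leI)

text \<open>Jensen's inequality for the convex function \<open>max 0\<close>, which is the
  truncation that \<open>ennreal\<close> performs.\<close>

lemma ennreal_integral_le:
  fixes f :: "'w \<Rightarrow> real"
  assumes "integrable M f"
  shows "ennreal (\<integral>x. f x \<partial>M) \<le> (\<integral>\<^sup>+x. ennreal (f x) \<partial>M)"
proof -
  have "ennreal (\<integral>x. f x \<partial>M) \<le> ennreal (\<integral>x. max 0 (f x) \<partial>M)"
    using assms by (intro ennreal_leI integral_mono) auto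
  also have "\<dots> = (\<integral>\<^sup>+x. ennreal (max 0 (f x)) \<partial>M)"
    using assms by (intro nn_integral_eq_integral[symmetric]) auto
  finally show ?thesis by (simp add: ennreal_max_0)
qed

text \<open>The left side is a supremum over pairs \<open>u\<close>, \<open>v\<close>. A pair with
  both terms nonnegative is dominated on the right by itself or by the exchanged pair, since
  \<open>h u + h v\<close> is symmetric. The assumptions on 0 serve the pairs whose second term is
  negative.\<close>

lemma contraction_abs_inner:
  fixes D :: "'a::real_inner set" and h :: "'a \<Rightarrow> real"
  assumes "0 \<in> D" "h 0 = 0"
  shows "(SUP u\<in>D. ennreal (h u + \<bar>a \<bullet> u\<bar>)) + (SUP u\<in>D. ennreal (h u - \<bar>a \<bullet> u\<bar>))
    \<le> (SUP u\<in>D. ennreal (h u + a \<bullet> u)) + (SUP u\<in>D. ennreal (h u + (- a) \<bullet> u))" (is "_ \<le> ?R")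
proof -
  have pair: "ennreal (h u + a \<bullet> u) + ennreal (h v + (- a) \<bullet> v) \<le> ?R" if "u \<in> D" "v \<in> D" for u v
    using that by (intro add_mono SUP_upper)
  have nonneg: "ennreal (h u + \<bar>a \<bullet> u\<bar>) + ennreal (h v - \<bar>a \<bullet> v\<bar>) \<le> ?R"
    if uv: "u \<in> D" "v \<in> D" and "0 \<le> h v - \<bar>a \<bullet> v\<bar>" for u v
  proof -
    \<comment> \<open>The two alternatives are the two signs of
      \<open>a \<bullet> (u - v)\<close>.\<close>
    have "h u + \<bar>a \<bullet> u\<bar> + (h v - \<bar>a \<bullet> v\<bar>) \<le> h u + a \<bullet> u + (h v + (- a) \<bullet> v) \<or>
        h u + \<bar>a \<bullet> u\<bar> + (h v - \<bar>a \<bullet> v\<bar>) \<le> h v + a \<bullet> v + (h u + (- a) \<bullet> u)"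
      by auto
    then obtain u' v' where *: "u' \<in> D" "v' \<in> D"
        "h u + \<bar>a \<bullet> u\<bar> + (h v - \<bar>a \<bullet> v\<bar>) \<le> h u' + a \<bullet> u' + (h v' + (- a) \<bullet> v')"
      using uv by blast
    have "ennreal (h u + \<bar>a \<bullet> u\<bar>) + ennreal (h v - \<bar>a \<bullet> v\<bar>) \<le> ?R" if "0 \<le> h u + \<bar>a \<bullet> u\<bar>"
    proof -
      have "ennreal (h u + \<bar>a \<bullet> u\<bar>) + ennreal (h v - \<bar>a \<bullet> v\<bar>) = ennreal (h u + \<bar>a \<bullet> u\<bar> + (h v - \<bar>a \<bullet> v\<bar>))"
        using that \<open>0 \<le> h v - \<bar>a \<bullet> v\<bar>\<close> by (rule ennreal_plus[symmetric])
      also have "\<dots> \<le> ennreal (h u' + a \<bullet> u') + ennreal (h v' + (- a) \<bullet> v')"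
        by (rule order_trans[OF ennreal_leI[OF *(3)] ennreal_add_le])
      finally show ?thesis using pair[OF *(1,2)] by (rule order_trans)
    qed
    \<comment> \<open>The first term is truncated to 0, and the second is at most
      \<open>h v + a \<bullet> v\<close>.\<close>
    moreover have "ennreal (h u + \<bar>a \<bullet> u\<bar>) + ennreal (h v - \<bar>a \<bullet> v\<bar>) \<le> ?R" if "h u + \<bar>a \<bullet> u\<bar> < 0"
    proof -
      have "ennreal (h u + \<bar>a \<bullet> u\<bar>) + ennreal (h v - \<bar>a \<bullet> v\<bar>) \<le> ennreal (h v + a \<bullet> v)"
        using that by (simp add: ennreal_neg ennreal_leI)
      also have "\<dots> \<le> ?R" using pair[OF uv(2) uv(2)] by (rule order_trans[rotated]) simp
      finally show ?thesis .
    qed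
    ultimately show ?thesis by (cases "0 \<le> h u + \<bar>a \<bullet> u\<bar>") auto
  qed
  \<comment> \<open>A negative second term has the same truncation as the term at
    \<open>v = 0\<close>, which is \<open>h 0 = 0\<close>.\<close>
  have all: "ennreal (h u + \<bar>a \<bullet> u\<bar>) + ennreal (h v - \<bar>a \<bullet> v\<bar>) \<le> ?R" if "u \<in> D" "v \<in> D" for u v
    using nonneg[OF that] nonneg[OF that(1) assms(1)] assms(2)
    by (cases "0 \<le> h v - \<bar>a \<bullet> v\<bar>") (auto simp: ennreal_neg)
  have "D \<noteq> {}" using assms by auto
  then show ?thesis
    by (subst ennreal_SUP_add_left[symmetric], assumption, subst ennreal_SUP_add_right, assumption)
      (intro SUP_least all)
qed

text \<open>\<open>h\<close> carries the contribution of the rows held fixed. The mean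
  \<open>sqrt (2 / pi) * norm u\<close> becomes an integral over a copy \<open>a'\<close>, and a
  supremum of integrals is at most the integral of the supremum.\<close>

lemma symmetrization_step:
  fixes D :: "(real ^ 'n) set"
  assumes [simp]: "countable D" and "0 \<in> D" "h 0 = 0"
  shows "(\<integral>\<^sup>+a. (SUP u\<in>D. ennreal (h u + (sqrt (2 / pi) * norm u - \<bar>a \<bullet> u\<bar>))) \<partial>std_gaussian)
    \<le> (\<integral>\<^sup>+a. (SUP u\<in>D. ennreal (h u + 2 * (a \<bullet> u))) \<partial>std_gaussian)"
proof -
  let ?G = "std_gaussian :: (real ^ 'n) measure"
  interpret prob_space ?G by (rule prob_space_std_gaussian)
  \<comment> \<open>Each of the two suprema keeps one half of \<open>h\<close>; the halves are
    reunited in \<open>2 * R a\<close>.\<close>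
  define P where "P a = (SUP u\<in>D. ennreal (h u / 2 + \<bar>a \<bullet> u\<bar>))" for a
  define Q where "Q a = (SUP u\<in>D. ennreal (h u / 2 - \<bar>a \<bullet> u\<bar>))" for a
  define R where "R a = (SUP u\<in>D. ennreal (h u / 2 + a \<bullet> u))" for a
  have [measurable]: "P \<in> borel_measurable borel" "Q \<in> borel_measurable borel" "R \<in> borel_measurable borel"
    unfolding P_def[abs_def] Q_def[abs_def] R_def[abs_def] by measurable
  have "(SUP u\<in>D. ennreal (h u + (sqrt (2 / pi) * norm u - \<bar>a \<bullet> u\<bar>))) \<le> (\<integral>\<^sup>+a'. P a' + Q a \<partial>?G)" for a
  proof (rule SUP_least)
    fix u assume u: "u \<in> D"
    note I = has_bochner_integral_std_gaussian_abs_inner[of u, unfolded has_bochner_integral_iff]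
    have "h u + (sqrt (2 / pi) * norm u - \<bar>a \<bullet> u\<bar>) = (\<integral>a'. (h u / 2 + \<bar>a' \<bullet> u\<bar>) + (h u / 2 - \<bar>a \<bullet> u\<bar>) \<partial>?G)"
      using I prob_space by simp
    also have "ennreal \<dots> \<le> (\<integral>\<^sup>+a'. ennreal ((h u / 2 + \<bar>a' \<bullet> u\<bar>) + (h u / 2 - \<bar>a \<bullet> u\<bar>)) \<partial>?G)"
      using I by (intro ennreal_integral_le) auto
    also have "\<dots> \<le> (\<integral>\<^sup>+a'. P a' + Q a \<partial>?G)"
      unfolding P_def Q_def
      by (intro nn_integral_mono order_trans[OF ennreal_add_le] add_mono SUP_upper u)
    finally show "ennreal (h u + (sqrt (2 / pi) * norm u - \<bar>a \<bullet> u\<bar>)) \<le> (\<integral>\<^sup>+a'. P a' + Q a \<partial>?G)" .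
  qed
  then have "(\<integral>\<^sup>+a. (SUP u\<in>D. ennreal (h u + (sqrt (2 / pi) * norm u - \<bar>a \<bullet> u\<bar>))) \<partial>?G)
      \<le> (\<integral>\<^sup>+a. (\<integral>\<^sup>+a'. P a' + Q a \<partial>?G) \<partial>?G)"
    by (rule nn_integral_mono)
  \<comment> \<open>The integrand is a function of \<open>a'\<close> plus a function of
    \<open>a\<close>, both with law \<open>std_gaussian\<close>, so both may be evaluated at the
    same point.\<close>
  also have "\<dots> = (\<integral>\<^sup>+a. P a + Q a \<partial>?G)"
    using emeasure_space_1 by (simp add: nn_integral_add)
  also have "\<dots> \<le> (\<integral>\<^sup>+a. R a + R (- a) \<partial>?G)"
    unfolding P_def Q_def R_def using assms
    by (intro nn_integral_mono contraction_abs_inner) auto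
  also have "\<dots> = (\<integral>\<^sup>+a. R a \<partial>?G) + (\<integral>\<^sup>+a. R a \<partial>distr ?G borel uminus)"
    by (simp add: nn_integral_add nn_integral_distr)
  also have "\<dots> = (\<integral>\<^sup>+a. 2 * R a \<partial>?G)"
    by (simp add: std_gaussian_symmetric nn_integral_add mult_2)
  also have "(\<lambda>a. 2 * R a) = (\<lambda>a. SUP u\<in>D. ennreal (h u + 2 * (a \<bullet> u)))"
  proof
    fix a
    have "2 * ennreal r = ennreal (2 * r)" for r
      by (simp add: ennreal_mult')
    then show "2 * R a = (SUP u\<in>D. ennreal (h u + 2 * (a \<bullet> u)))"
      unfolding R_def SUP_mult_left_ennreal by (simp add: distrib_left)
  qed
  finally show ?thesis .
qed

lemma symmetrization_product:
  fixes D :: "(real ^ 'n) set"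
  assumes "finite I" and [simp]: "countable D" and "0 \<in> D" "h 0 = 0"
  shows "(\<integral>\<^sup>+a. (SUP u\<in>D. ennreal (h u + (\<Sum>i\<in>I. sqrt (2 / pi) * norm u - \<bar>a i \<bullet> u\<bar>)))
        \<partial>(\<Pi>\<^sub>M i\<in>I. std_gaussian))
    \<le> (\<integral>\<^sup>+a. (SUP u\<in>D. ennreal (h u + 2 * ((\<Sum>i\<in>I. a i) \<bullet> u))) \<partial>(\<Pi>\<^sub>M i\<in>I. std_gaussian))"
  using assms(1,4)
\<comment> \<open>\<open>h\<close> must vary: once a row is replaced, its linear term joins
  \<open>h\<close>.\<close>
proof (induction I arbitrary: h)
  case empty
  show ?case by simp
next
  case (insert i I)
  let ?G = "std_gaussian :: (real ^ 'n) measure"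
  interpret prob_space ?G by (rule prob_space_std_gaussian)
  interpret product_sigma_finite "\<lambda>_. ?G" by standard
  let ?c = "sqrt (2 / pi)"
  let ?S = "\<lambda>a u. \<Sum>k\<in>I. ?c * norm u - \<bar>a k \<bullet> u\<bar>"
  have upd: "(\<Sum>k\<in>I. f ((a(i := b)) k)) = (\<Sum>k\<in>I. f (a k))" for a b and f :: "real ^ 'n \<Rightarrow> 'z::comm_monoid_add"
    using insert.hyps by (intro sum.cong) auto
  interpret PG: pair_sigma_finite ?G "\<Pi>\<^sub>M k\<in>I. ?G"
    by (intro pair_sigma_finite.intro sigma_finite insert.hyps) standard
  have "(\<integral>\<^sup>+a. (SUP u\<in>D. ennreal (h u + (\<Sum>k\<in>insert i I. ?c * norm u - \<bar>a k \<bullet> u\<bar>)))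
        \<partial>(\<Pi>\<^sub>M k\<in>insert i I. ?G))
      = (\<integral>\<^sup>+a. (\<integral>\<^sup>+b. (SUP u\<in>D. ennreal ((h u + ?S a u) + (?c * norm u - \<bar>b \<bullet> u\<bar>))) \<partial>?G) \<partial>(\<Pi>\<^sub>M k\<in>I. ?G))"
    using insert.hyps
    by (subst product_nn_integral_insert) (simp_all add: upd[of "\<lambda>x. _ - \<bar>x \<bullet> _\<bar>"] fun_upd_same add_ac del: fun_upd_apply)
  \<comment> \<open>Row \<open>i\<close> is replaced with the deviations of the remaining rows
    absorbed into \<open>h\<close>.\<close>
  also have "\<dots> \<le> (\<integral>\<^sup>+a. (\<integral>\<^sup>+b. (SUP u\<in>D. ennreal ((h u + ?S a u) + 2 * (b \<bullet> u))) \<partial>?G) \<partial>(\<Pi>\<^sub>M k\<in>I. ?G))"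
    using insert.prems \<open>0 \<in> D\<close> by (intro nn_integral_mono symmetrization_step) auto
  \<comment> \<open>Interchanging the integrals fixes \<open>b\<close>, so that the induction
    hypothesis applies to \<open>h u + 2 * (b \<bullet> u)\<close>, which again vanishes at
    0.\<close>
  also have "\<dots> = (\<integral>\<^sup>+b. (\<integral>\<^sup>+a. (SUP u\<in>D. ennreal ((h u + 2 * (b \<bullet> u)) + ?S a u)) \<partial>(\<Pi>\<^sub>M k\<in>I. ?G)) \<partial>?G)"
    by (subst PG.Fubini') (simp_all add: add_ac)
  also have "\<dots> \<le> (\<integral>\<^sup>+b. (\<integral>\<^sup>+a. (SUP u\<in>D. ennreal ((h u + 2 * (b \<bullet> u)) + 2 * ((\<Sum>k\<in>I. a k) \<bullet> u))) \<partial>(\<Pi>\<^sub>M k\<in>I. ?G)) \<partial>?G)"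
    using insert.prems by (intro nn_integral_mono insert.IH) auto
  also have "\<dots> = (\<integral>\<^sup>+a. (SUP u\<in>D. ennreal (h u + 2 * ((\<Sum>k\<in>insert i I. a k) \<bullet> u))) \<partial>(\<Pi>\<^sub>M k\<in>insert i I. ?G))"
    using insert.hyps
    by (subst product_nn_integral_insert_rev) (simp_all add: upd[of "\<lambda>x. x"] fun_upd_same inner_add_left distrib_left add_ac del: fun_upd_apply)
  finally show ?case .
qed

section \<open>Independence and laws of the rows of the random matrix\<close>

lemma (in prob_space) indep_vars_groups:
  assumes "indep_vars (\<lambda>_. borel) X I" "\<And>l. l \<in> L \<Longrightarrow> J l \<subseteq> I" "disjoint_family_on J L"
    and "\<And>l. l \<in> L \<Longrightarrow> Y l \<in> borel_measurable (\<Pi>\<^sub>M i\<in>J l. borel)"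
  shows "indep_vars (\<lambda>_. borel) (\<lambda>l \<omega>. Y l (\<lambda>i\<in>J l. X i \<omega>)) L"
  by (rule indep_vars_compose2[OF indep_vars_restrict[OF assms(1-3)]]) (use assms(4) in auto)

context
  fixes M :: "'w measure" and A :: "'w \<Rightarrow> real ^ 'n ^ 'm"
  assumes M: "prob_space M" and A: "iid_std_normal_matrix M A"
begin

interpretation prob_space M by (rule M)

lemma indep_entries: "indep_vars (\<lambda>_. borel) (\<lambda>p \<omega>. A \<omega> $ fst p $ snd p) UNIV"
  using A by (simp add: iid_std_normal_matrix_def case_prod_beta')

lemma distributed_entries: "distributed M lborel (\<lambda>\<omega>. A \<omega> $ i $ j) std_normal_density"
  using A by (simp add: iid_std_normal_matrix_def)

lemma measurable_entries [measurable]: "(\<lambda>\<omega>. A \<omega> $ i $ j) \<in> borel_measurable M"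
  using distributed_measurable[OF distributed_entries] by simp

lemma measurable_rows [measurable]: "(\<lambda>\<omega>. A \<omega> $ i) \<in> borel_measurable M"
proof -
  have "(\<lambda>\<omega>. \<chi> j. A \<omega> $ i $ j) \<in> borel_measurable M" by measurable
  then show ?thesis by simp
qed

lemma indep_rows: "indep_vars (\<lambda>_. borel) (\<lambda>i \<omega>. A \<omega> $ i) UNIV"
proof -
  have "indep_vars (\<lambda>_. borel)
      (\<lambda>i \<omega>. (\<lambda>f. \<chi> j. f (i, j)) (\<lambda>p\<in>{i} \<times> UNIV. A \<omega> $ fst p $ snd p)) UNIV"
    by (rule indep_vars_groups[OF indep_entries]) (auto simp: disjoint_family_on_def)
  then show ?thesis by (simp add: restrict_def)
qed

lemma distr_row: "distr M borel (\<lambda>\<omega>. A \<omega> $ i) = std_gaussian"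
proof -
  \<comment> \<open>Blocks of one entry each restrict the family to row \<open>i\<close> and reindex
    it by \<open>j\<close>.\<close>
  have "indep_vars (\<lambda>_. borel) (\<lambda>j \<omega>. (\<lambda>f. f (i, j)) (\<lambda>p\<in>{(i, j)}. A \<omega> $ fst p $ snd p)) UNIV"
    by (rule indep_vars_groups[OF indep_entries]) (auto simp: disjoint_family_on_def)
  then have "indep_vars (\<lambda>_. borel) (\<lambda>j \<omega>. A \<omega> $ i $ j) UNIV" by simp
  from distr_indep_std_normal[OF this distributed_entries] show ?thesis by simp
qed

text \<open>Transfers integrals over \<open>M\<close> to the product space on which
  \<open>symmetrization_product\<close> lives.\<close>

lemma distr_rows:
  "distr M (\<Pi>\<^sub>M i\<in>UNIV. std_gaussian) (\<lambda>\<omega>. \<lambda>i\<in>UNIV. A \<omega> $ i) = (\<Pi>\<^sub>M i\<in>UNIV. std_gaussian)"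
proof -
  have "distr M (\<Pi>\<^sub>M i\<in>UNIV. std_gaussian) (\<lambda>\<omega>. \<lambda>i\<in>UNIV. A \<omega> $ i)
      = distr M (\<Pi>\<^sub>M i\<in>UNIV. borel) (\<lambda>\<omega>. \<lambda>i\<in>UNIV. A \<omega> $ i)"
    by (intro distr_cong refl sets_PiM_cong sets_std_gaussian)
  also have "\<dots> = (\<Pi>\<^sub>M i\<in>UNIV. std_gaussian)"
    using indep_rows by (subst (asm) indep_vars_iff_distr_eq_PiM) (auto simp: distr_row)
  finally show ?thesis .
qed

text \<open>The columns of the index set are disjoint blocks, so the coordinates are independent.
  Each is a sum of \<open>CARD('m)\<close> independent standard normals, whose variance
  \<open>CARD('m)\<close> the factor normalizes.\<close>

lemma distr_sum_rows:
  "distr M borel (\<lambda>\<omega>. (1 / sqrt (real CARD('m))) *\<^sub>R (\<Sum>i\<in>UNIV. A \<omega> $ i)) = std_gaussian"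
proof -
  let ?s = "sqrt (real CARD('m))"
  have "indep_vars (\<lambda>_. borel)
      (\<lambda>j \<omega>. (\<lambda>f. (1 / ?s) * (\<Sum>i\<in>UNIV. f (i, j))) (\<lambda>p\<in>UNIV \<times> {j}. A \<omega> $ fst p $ snd p)) UNIV"
    by (rule indep_vars_groups[OF indep_entries]) (auto simp: disjoint_family_on_def)
  then have ind: "indep_vars (\<lambda>_. borel) (\<lambda>j \<omega>. (1 / ?s) * (\<Sum>i\<in>UNIV. A \<omega> $ i $ j)) UNIV"
    by simp
  have D: "distributed M lborel (\<lambda>\<omega>. (1 / ?s) * (\<Sum>i\<in>UNIV. A \<omega> $ i $ j)) std_normal_density" for j
  proof -
    have "indep_vars (\<lambda>_. borel) (\<lambda>i \<omega>. (\<lambda>f. f (i, j)) (\<lambda>p\<in>{(i, j)}. A \<omega> $ fst p $ snd p)) UNIV"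
      by (rule indep_vars_groups[OF indep_entries]) (auto simp: disjoint_family_on_def)
    then have "indep_vars (\<lambda>_. borel) (\<lambda>i \<omega>. A \<omega> $ i $ j) UNIV" by simp
    from sum_indep_normal[OF _ _ this, of "\<lambda>_. 1" "\<lambda>_. 0"]
    have "distributed M lborel (\<lambda>\<omega>. \<Sum>i\<in>UNIV. A \<omega> $ i $ j) (normal_density 0 ?s)"
      using distributed_entries by simp
    from normal_density_affine[OF this, of "1 / ?s" 0] show ?thesis by simp
  qed
  have "(\<lambda>\<omega>. \<chi> j. (1 / ?s) * (\<Sum>i\<in>UNIV. A \<omega> $ i $ j)) =
      (\<lambda>\<omega>. (1 / ?s) *\<^sub>R (\<Sum>i\<in>UNIV. A \<omega> $ i))"
    by (simp add: fun_eq_iff vec_eq_iff)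
  with distr_indep_std_normal[OF ind D] show ?thesis by simp
qed

text \<open>The factor is the 2 of symmetrization times the normalization of the row sum, whose law
  is again \<open>std_gaussian\<close>.\<close>

lemma expected_abs_deviation_le:
  assumes [simp]: "countable D" and "0 \<in> D"
  shows "(\<integral>\<^sup>+\<omega>. (SUP u\<in>D. ennreal (\<Sum>i\<in>UNIV. sqrt (2 / pi) * norm u - \<bar>A \<omega> $ i \<bullet> u\<bar>)) \<partial>M)
    \<le> ennreal (2 * sqrt (real CARD('m))) * (\<integral>\<^sup>+g. (SUP u\<in>D. ennreal (g \<bullet> u)) \<partial>std_gaussian)"
proof -
  let ?s = "sqrt (real CARD('m))"
  let ?R = "\<lambda>\<omega>. \<lambda>i\<in>UNIV. A \<omega> $ i"
  let ?P = "\<Pi>\<^sub>M i\<in>(UNIV :: 'm set). (std_gaussian :: (real ^ 'n) measure)"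
  have tr: "(\<integral>\<^sup>+\<omega>. f (\<lambda>i\<in>UNIV. A \<omega> $ i) \<partial>M) = (\<integral>\<^sup>+a. f a \<partial>?P)" if "f \<in> borel_measurable ?P" for f
    by (subst distr_rows[symmetric], subst nn_integral_distr) (use that in auto)
  have "(\<integral>\<^sup>+\<omega>. (SUP u\<in>D. ennreal (\<Sum>i\<in>UNIV. sqrt (2 / pi) * norm u - \<bar>A \<omega> $ i \<bullet> u\<bar>)) \<partial>M)
      = (\<integral>\<^sup>+a. (SUP u\<in>D. ennreal (0 + (\<Sum>i\<in>UNIV. sqrt (2 / pi) * norm u - \<bar>a i \<bullet> u\<bar>))) \<partial>?P)"
    by (subst tr[symmetric]) simp_all
  also have "\<dots> \<le> (\<integral>\<^sup>+a. (SUP u\<in>D. ennreal (0 + 2 * ((\<Sum>i\<in>UNIV. a i) \<bullet> u))) \<partial>?P)"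
    using assms by (intro symmetrization_product) auto
  also have "\<dots> = (\<integral>\<^sup>+\<omega>. (SUP u\<in>D. ennreal (0 + 2 * ((\<Sum>i\<in>UNIV. A \<omega> $ i) \<bullet> u))) \<partial>M)"
    by (subst tr[symmetric]) simp_all
  also have "\<dots> = (\<integral>\<^sup>+\<omega>. ennreal (2 * ?s) *
      (SUP u\<in>D. ennreal (((1 / ?s) *\<^sub>R (\<Sum>i\<in>UNIV. A \<omega> $ i)) \<bullet> u)) \<partial>M)"
    by (simp add: SUP_mult_left_ennreal flip: ennreal_mult')
  also have "\<dots> = ennreal (2 * ?s) *
      (\<integral>\<^sup>+g. (SUP u\<in>D. ennreal (g \<bullet> u)) \<partial>distr M borel (\<lambda>\<omega>. (1 / ?s) *\<^sub>R (\<Sum>i\<in>UNIV. A \<omega> $ i)))"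
    by (subst nn_integral_distr) (simp_all add: nn_integral_cmult)
  finally show ?thesis by (simp only: distr_sum_rows)
qed

end

section \<open>Integrability and the Gaussian mean width\<close>

lemma integrable_std_gaussian_norm: "integrable std_gaussian (norm :: real ^ 'k \<Rightarrow> real)"
proof (rule Bochner_Integration.integrable_bound)
  have "integrable std_gaussian (\<lambda>x :: real ^ 'k. \<bar>x $ i\<bar>)" for i
    using has_bochner_integral_std_gaussian_abs_inner[of "axis i 1"]
    by (simp add: has_bochner_integral_iff inner_axis)
  then show "integrable std_gaussian (\<lambda>x :: real ^ 'k. \<Sum>i\<in>UNIV. \<bar>x $ i\<bar>)" by simp
  show "AE x :: real ^ 'k in std_gaussian. norm (norm x) \<le> norm (\<Sum>i\<in>UNIV. \<bar>x $ i\<bar>)"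
    using norm_le_l1_cart by (auto simp: sum_nonneg)
qed measurable

text \<open>The mean width is a Bochner integral, which would be 0 for a non-integrable supremum.
  Hence the supremum \<open>s\<close> over all of \<open>K - K\<close> is shown measurable, by
  Lipschitz continuity, and integrable, by domination with a multiple of the norm.\<close>

lemma nn_integral_SUP_le_gaussian_mean_width:
  fixes K :: "(real ^ 'n) set"
  assumes "bounded K" "K \<noteq> {}" and D: "D \<subseteq> {u - v | u v. u \<in> K \<and> v \<in> K}"
  shows "(\<integral>\<^sup>+g. (SUP u\<in>D. ennreal (g \<bullet> u)) \<partial>std_gaussian) \<le> ennreal (gaussian_mean_width K)"
    and "0 \<le> gaussian_mean_width K"
proof -
  let ?T = "{u - v | u v. u \<in> K \<and> v \<in> K}"
  define s where "s g = (SUP u\<in>?T. g \<bullet> u)" for g :: "real ^ 'n"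
  obtain b where "\<And>u. u \<in> K \<Longrightarrow> norm u \<le> b"
    using assms(1) by (auto simp: bounded_iff)
  then have "norm (u - v) \<le> b + b" if "u \<in> K" "v \<in> K" for u v
    using that by (intro order_trans[OF norm_triangle_ineq4 add_mono])
  then obtain r where r: "\<And>u. u \<in> ?T \<Longrightarrow> norm u \<le> r"
    by blast
  have T0: "0 \<in> ?T" using assms(2) by force
  then have "?T \<noteq> {}" by blast
  have "0 \<le> r" using r[OF T0] by simp
  have bound: "g \<bullet> u \<le> r * norm g" if "u \<in> ?T" for g u
  proof -
    have "g \<bullet> u \<le> norm g * norm u" by (rule norm_cauchy_schwarz)
    also have "\<dots> \<le> norm g * r" by (intro mult_left_mono r that) simp
    finally show ?thesis by (simp add: mult.commute)
  qed
  have bdd: "bdd_above ((\<bullet>) g ` ?T)" for g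
    using bound by (intro bdd_aboveI2)
  have upper: "g \<bullet> u \<le> s g" if "u \<in> ?T" for g u
    unfolding s_def using bdd that by (rule cSUP_upper2[OF _ _ order_refl])
  have s0: "0 \<le> s g" for g
    using upper[OF T0, of g] by simp
  have s_le: "s g \<le> r * norm g" for g
    unfolding s_def using \<open>?T \<noteq> {}\<close> bound by (rule cSUP_least)
  \<comment> \<open>Split \<open>g \<bullet> u\<close> into \<open>g' \<bullet> u\<close> and
    \<open>(g - g') \<bullet> u\<close>; the bound on the latter is uniform in
    \<open>u\<close>.\<close>
  have lip: "s g \<le> s g' + r * norm (g - g')" for g g'
    unfolding s_def[of g]
  proof (rule cSUP_least[OF \<open>?T \<noteq> {}\<close>])
    fix u assume "u \<in> ?T"
    then show "g \<bullet> u \<le> s g' + r * norm (g - g')"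
      using upper[of u g'] bound[of u "g - g'"] by (simp add: inner_diff_left)
  qed
  have "\<bar>s g - s g'\<bar> \<le> r * norm (g - g')" for g g'
    using lip[of g g'] lip[of g' g] by (simp add: norm_minus_commute abs_le_iff)
  then have "r-lipschitz_on UNIV s"
    using \<open>0 \<le> r\<close> by (intro lipschitz_onI) (auto simp: dist_norm)
  then have [measurable]: "s \<in> borel_measurable borel"
    by (intro borel_measurable_continuous_onI lipschitz_on_continuous_on)
  have int: "integrable std_gaussian s"
  proof (rule Bochner_Integration.integrable_bound)
    show "integrable std_gaussian (\<lambda>g :: real ^ 'n. r * norm g)"
      by (intro integrable_mult_right integrable_std_gaussian_norm)
    show "AE g in std_gaussian. norm (s g) \<le> norm (r * norm g)"
      using s0 s_le by (auto intro: order_trans[OF _ abs_ge_self])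
  qed measurable
  have "(\<integral>\<^sup>+g. (SUP u\<in>D. ennreal (g \<bullet> u)) \<partial>std_gaussian) \<le> (\<integral>\<^sup>+g. ennreal (s g) \<partial>std_gaussian)"
    using D upper by (intro nn_integral_mono SUP_least ennreal_leI) blast
  also have "\<dots> = ennreal (gaussian_mean_width K)"
    unfolding gaussian_mean_width_def s_def[symmetric] using int s0 by (intro nn_integral_eq_integral) auto
  finally show "(\<integral>\<^sup>+g. (SUP u\<in>D. ennreal (g \<bullet> u)) \<partial>std_gaussian) \<le> ennreal (gaussian_mean_width K)" .
  show "0 \<le> gaussian_mean_width K"
    unfolding gaussian_mean_width_def s_def[symmetric] using s0 by (simp add: Bochner_Integration.integral_nonneg)
qed

section \<open>Passage from a dense subset and the recovery bound\<close>

lemma ennreal_le_SUP_dense: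
  fixes f :: "'a::first_countable_topology \<Rightarrow> real"
  assumes "u \<in> closure D" "continuous_on UNIV f"
  shows "ennreal (f u) \<le> (SUP v\<in>D. ennreal (f v))"
proof -
  have "f u \<in> closure (f ` D)"
    using assms continuous_image_closure_subset[of UNIV f D] by auto
  \<comment> \<open>This closed set contains the image of \<open>D\<close>, hence also the limit
    value \<open>f u\<close>.\<close>
  have "closed {t. ennreal t \<le> (SUP v\<in>D. ennreal (f v))}"
    by (intro closed_Collect_le continuous_on_ennreal continuous_on_const continuous_on_id)
  then have "closure (f ` D) \<subseteq> {t. ennreal t \<le> (SUP v\<in>D. ennreal (f v))}"
    by (intro closure_minimal) (auto intro: SUP_upper)
  with \<open>f u \<in> closure (f ` D)\<close> show ?thesis by auto
qed

lemma outer_expectation_le: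
  assumes "h \<in> borel_measurable M" "\<And>\<omega>. \<omega> \<in> space M \<Longrightarrow> f \<omega> \<le> h \<omega>"
  shows "outer_expectation M f \<le> (\<integral>\<^sup>+\<omega>. h \<omega> \<partial>M)"
  unfolding outer_expectation_def using assms by (intro INF_lower) auto

theorem theorem6p1:
  fixes M :: "'w measure"
    and A :: "'w \<Rightarrow> real ^ 'n ^ 'm"
    and K :: "(real ^ 'n) set"
    and \<epsilon> :: real
    and \<nu> :: "'w \<Rightarrow> real ^ 'n \<Rightarrow> real ^ 'm"
    and y :: "'w \<Rightarrow> real ^ 'n \<Rightarrow> real ^ 'm"
    and xhat :: "real ^ 'n ^ 'm \<Rightarrow> real ^ 'm \<Rightarrow> real ^ 'n"
  assumes "prob_space M"
    and "iid_std_normal_matrix M A"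
    and "bounded K"
    and "\<epsilon> \<ge> 0"
    and "\<And>\<omega> x. \<omega> \<in> space M \<Longrightarrow> x \<in> K \<Longrightarrow> y \<omega> x = A \<omega> *v x + \<nu> \<omega> x"
    and "\<And>\<omega> x. \<omega> \<in> space M \<Longrightarrow> x \<in> K \<Longrightarrow> 1 / real CARD('m) * l1_norm (\<nu> \<omega> x) \<le> \<epsilon>"
    and "\<And>\<omega> x. \<omega> \<in> space M \<Longrightarrow> x \<in> K \<Longrightarrow> xhat (A \<omega>) (y \<omega> x) \<in> K"
    and "\<And>\<omega> x. \<omega> \<in> space M \<Longrightarrow> x \<in> K \<Longrightarrow>
           1 / real CARD('m) * l1_norm (A \<omega> *v xhat (A \<omega>) (y \<omega> x) - y \<omega> x) \<le> \<epsilon>"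
  shows "outer_expectation M (\<lambda>\<omega>. SUP x\<in>K. ennreal (norm (xhat (A \<omega>) (y \<omega> x) - x)))
           \<le> ennreal (sqrt (8 * pi) * (gaussian_mean_width K / sqrt (real CARD('m)) + \<epsilon>))"
proof (cases "K = {}")
  case True
  \<comment> \<open>The supremum over the empty set is 0 in \<open>ennreal\<close>.\<close>
  then show ?thesis
    using outer_expectation_le[of "\<lambda>_. 0" M "\<lambda>_. 0"] by (simp add: bot_ennreal)
next
  case False
  interpret prob_space M by fact
  note [measurable] = measurable_rows[OF assms(1,2)]
  let ?m = "real CARD('m)"
  let ?T = "{u - v | u v. u \<in> K \<and> v \<in> K}"
  define w where "w = gaussian_mean_width K"
  \<comment> \<open>The reciprocal of \<open>sqrt (2 / pi)\<close>; it turns a mean absolute value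
    back into a norm.\<close>
  define \<kappa> where "\<kappa> = sqrt (pi / 2)"
  obtain D0 where D0: "countable D0" "D0 \<subseteq> ?T" "?T \<subseteq> closure D0"
    by (rule separable)
  \<comment> \<open>Symmetrization needs 0 in the index set, and a countable dense set may miss
    it.\<close>
  define D where "D = insert 0 D0"
  have "0 \<in> ?T" using False by force
  with D0 have D: "D \<subseteq> ?T" "0 \<in> D" and [simp]: "countable D" and dense: "?T \<subseteq> closure D"
    using closure_mono[OF subset_insertI[of D0 0]] unfolding D_def by (simp, simp, simp, blast)
  define S where "S \<omega> u = (\<Sum>i\<in>UNIV. sqrt (2 / pi) * norm u - \<bar>A \<omega> $ i \<bullet> u\<bar>)" for \<omega> u
  define B where "B \<omega> = (SUP u\<in>D. ennreal (S \<omega> u))" for \<omega>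
  have [measurable]: "B \<in> borel_measurable M"
    unfolding B_def[abs_def] S_def by measurable
  have "0 \<le> \<kappa>" by (simp add: \<kappa>_def)
  \<comment> \<open>This bound is pointwise in \<open>\<omega>\<close> and uniform in
    \<open>x\<close>, whatever the noise and the estimator; its right side is a measurable majorant
    for the outer expectation.\<close>
  have majorant: "(SUP x\<in>K. ennreal (norm (xhat (A \<omega>) (y \<omega> x) - x))) \<le> ennreal (\<kappa> / ?m) * B \<omega> + ennreal (2 * \<kappa> * \<epsilon>)"
    if \<omega>: "\<omega> \<in> space M" for \<omega>
  proof (rule SUP_least)
    fix x assume x: "x \<in> K"
    define u where "u = xhat (A \<omega>) (y \<omega> x) - x"
    have "u \<in> ?T" using assms(7)[OF \<omega> x] x by (auto simp: u_def)
    \<comment> \<open>Residual plus noise: each has l1 norm at most \<open>?m * \<epsilon>\<close>,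
      which explains the later \<open>2 * ?m * \<epsilon>\<close>.\<close>
    have "A \<omega> *v u = (A \<omega> *v xhat (A \<omega>) (y \<omega> x) - y \<omega> x) + \<nu> \<omega> x"
      by (simp add: u_def assms(5)[OF \<omega> x] matrix_vector_mult_diff_distrib)
    then have "l1_norm (A \<omega> *v u) \<le> l1_norm (A \<omega> *v xhat (A \<omega>) (y \<omega> x) - y \<omega> x) + l1_norm (\<nu> \<omega> x)"
      by (auto simp: l1_norm_def simp flip: sum.distrib intro!: sum_mono abs_triangle_ineq)
    also have "\<dots> \<le> ?m * \<epsilon> + ?m * \<epsilon>"
      using assms(6)[OF \<omega> x] assms(8)[OF \<omega> x] by (intro add_mono) (simp_all add: field_simps)
    finally have l1: "(\<Sum>i\<in>UNIV. \<bar>A \<omega> $ i \<bullet> u\<bar>) \<le> 2 * ?m * \<epsilon>"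
      by (simp add: l1_norm_def matrix_vector_mul_component ac_simps)
    have "\<kappa> * sqrt (2 / pi) = 1"
      by (simp add: \<kappa>_def flip: real_sqrt_mult)
    then have "norm u = \<kappa> / ?m * (?m * (sqrt (2 / pi) * norm u))"
      by simp
    also have "?m * (sqrt (2 / pi) * norm u) = S \<omega> u + (\<Sum>i\<in>UNIV. \<bar>A \<omega> $ i \<bullet> u\<bar>)"
      by (simp add: S_def sum_subtractf)
    also have "\<kappa> / ?m * (S \<omega> u + (\<Sum>i\<in>UNIV. \<bar>A \<omega> $ i \<bullet> u\<bar>)) \<le> \<kappa> / ?m * (S \<omega> u + 2 * ?m * \<epsilon>)"
      using l1 \<open>0 \<le> \<kappa>\<close> by (intro mult_left_mono add_left_mono) auto
    also have "\<dots> = \<kappa> / ?m * S \<omega> u + 2 * \<kappa> * \<epsilon>"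
      by (simp add: distrib_left)
    finally have "ennreal (norm u) \<le> ennreal (\<kappa> / ?m * S \<omega> u) + ennreal (2 * \<kappa> * \<epsilon>)"
      by (rule order_trans[OF ennreal_leI ennreal_add_le])
    also have "ennreal (\<kappa> / ?m * S \<omega> u) = ennreal (\<kappa> / ?m) * ennreal (S \<omega> u)"
      using \<open>0 \<le> \<kappa>\<close> by (intro ennreal_mult') simp
    \<comment> \<open>\<open>u\<close> need not lie in the countable \<open>D\<close>; density in
      \<open>K - K\<close> and continuity of \<open>S \<omega>\<close> bridge the gap.\<close>
    also have "ennreal (S \<omega> u) \<le> B \<omega>"
      unfolding B_def
    proof (rule ennreal_le_SUP_dense)
      show "u \<in> closure D" using \<open>u \<in> ?T\<close> dense by blast
      show "continuous_on UNIV (S \<omega>)" unfolding S_def by (intro continuous_intros)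
    qed
    finally show "ennreal (norm (xhat (A \<omega>) (y \<omega> x) - x)) \<le> ennreal (\<kappa> / ?m) * B \<omega> + ennreal (2 * \<kappa> * \<epsilon>)"
      by (simp add: u_def mult_left_mono add_right_mono)
  qed
  have "0 \<le> w"
    unfolding w_def by (rule nn_integral_SUP_le_gaussian_mean_width(2)[OF \<open>bounded K\<close> False D(1)])
  have "(\<integral>\<^sup>+\<omega>. B \<omega> \<partial>M) \<le> ennreal (2 * sqrt ?m) * ennreal w"
    unfolding B_def S_def w_def
    by (rule order_trans[OF expected_abs_deviation_le[OF assms(1,2)]])
      (use D nn_integral_SUP_le_gaussian_mean_width(1)[OF \<open>bounded K\<close> False D(1)] in \<open>auto intro: mult_left_mono\<close>)
  have "outer_expectation M (\<lambda>\<omega>. SUP x\<in>K. ennreal (norm (xhat (A \<omega>) (y \<omega> x) - x)))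
      \<le> (\<integral>\<^sup>+\<omega>. ennreal (\<kappa> / ?m) * B \<omega> + ennreal (2 * \<kappa> * \<epsilon>) \<partial>M)"
    using majorant by (intro outer_expectation_le) auto
  also have "\<dots> = ennreal (\<kappa> / ?m) * (\<integral>\<^sup>+\<omega>. B \<omega> \<partial>M) + ennreal (2 * \<kappa> * \<epsilon>)"
    by (simp add: nn_integral_add nn_integral_cmult emeasure_space_1)
  also have "\<dots> \<le> ennreal (\<kappa> / ?m) * (ennreal (2 * sqrt ?m) * ennreal w) + ennreal (2 * \<kappa> * \<epsilon>)"
    by (intro add_right_mono mult_left_mono zero_le) fact
  also have "\<dots> = ennreal (\<kappa> / ?m * (2 * sqrt ?m * w) + 2 * \<kappa> * \<epsilon>)"
    using \<open>0 \<le> \<kappa>\<close> \<open>0 \<le> w\<close> \<open>0 \<le> \<epsilon>\<close> by (simp flip: ennreal_mult ennreal_plus)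
  also have "\<kappa> / ?m * (2 * sqrt ?m * w) + 2 * \<kappa> * \<epsilon> = 2 * \<kappa> * (w / sqrt ?m + \<epsilon>)"
    by (simp add: field_simps)
  \<comment> \<open>Here \<open>2 * \<kappa>\<close> is \<open>sqrt (2 * pi)\<close>, half of the
    stated constant.\<close>
  also have "ennreal \<dots> \<le> ennreal (sqrt (8 * pi) * (w / sqrt ?m + \<epsilon>))"
  proof (intro ennreal_leI mult_right_mono)
    have "2 * \<kappa> = sqrt (2\<^sup>2 * (pi / 2))"
      by (simp only: \<kappa>_def real_sqrt_mult real_sqrt_abs)
    then show "2 * \<kappa> \<le> sqrt (8 * pi)" by simp
  qed (use \<open>0 \<le> w\<close> \<open>0 \<le> \<epsilon>\<close> in auto)
  finally show ?thesis by (simp only: w_def)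
qed

end
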